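(* The following four properties all hold for the $\alpha$-loss $\ell^\alpha$. (a) (M), (D), (S) all hold, for every $\alpha\in\mathbb R\setminus\{0\}$. (b) If $\alpha=0$, or if $\alpha=\pm\infty$ and $\eta_t=1/2$, then $t_{\ell^\alpha}(\eta_t)=[0,1]$. If $\alpha\in\mathbb R\setminus\{0,\pm\infty\}$, then $t_{\ell^\alpha}(\eta_t)=\left\{\frac{\eta_t^\alpha}{\eta_t^\alpha+(1-\eta_t)^\alpha}\right\}$. If $\alpha\to\pm\infty$, then $t_{\ell^{\pm\infty}}(\eta_t)$ is an extreme value of $[0,1]$ depending on the sign of $\eta_t-1/2$: for $+\infty$ it is $1$ when $\eta_t>1/2$ and $0$ when $\eta_t<1/2$; for $-\infty$ it is $0$ when $\eta_t>1/2$ and $1$ when $\eta_t<1/2$. (c) Hence, the $\alpha$-loss is twist-proper with $\alpha^*=\mathrm{logit}(\eta_c)/\mathrm{logit}(\eta_t)$. (d) For any Bayes blunting twist, $\alpha^*\ge1$.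
   Context: A class probability estimation loss $\ell:\{-1,1\}\times[0,1]\to\mathbb R$ has partial losses $\ell_1,\ell_{-1}$: $\ell(y,u)=\ell_y(u)$. Its pointwise conditional risk is $L(u,v)=v\,\ell_1(u)+(1-v)\,\ell_{-1}(u)$, and its (set-valued) Bayes tilted estimate is $t_\ell(v)=\arg\inf_{u\in[0,1]}L(u,v)$. Properties: (M) monotonicity: $\ell_1$ is non-increasing and $\ell_{-1}$ is non-decreasing; (D) differentiability: $\ell_1$ and $\ell_{-1}$ are differentiable; (S) symmetry: $\ell_1(u)=\ell_{-1}(1-u)$ for all $u\in[0,1]$. $\alpha$-loss: for $\alpha\ge0$ and all $u\in[0,1]$, $\ell_1^\alpha(u)=\ell_{-1}^\alpha(1-u)$ where $\ell_1^\alpha(u)=\frac{\alpha}{\alpha-1}\big(1-u^{(\alpha-1)/\alpha}\big)$, and by continuity $\ell_1^0(u)=\infty$, $\ell_1^1(u)=-\log u$, $\ell_1^\infty(u)=1-u$. For $\alpha<0$ and all $u\in[0,1]$, $\ell_1^\alpha(u)=\ell_{-1}^{-\alpha}(u)=\ell_1^{-\alpha}(1-u)$; the loss is again symmetric, $\ell_{-1}^\alpha(u)=\ell_1^\alpha(1-u)$. A twist is a general mapping $\eta_c\mapsto\eta_t$ from a clean posterior $\eta_c\in[0,1]$ to a twisted posterior $\eta_t\in[0,1]$ (probabilities that $Y=1$ given $X=x$). It is Bayes blunting iff $(\eta_c\le\eta_t\le1/2)\vee(\eta_c\ge\eta_t\ge1/2)$. A loss is twist-proper iff for any twist there exist hyperparameter(s)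 (here $\alpha$) such that $\eta_c\in t_\ell(\eta_t)$. For $u\in[0,1]$, $\mathrm{logit}(u)=\log(u/(1-u))$.
   Formalization: (M) is false for α<0 (ℓ₁ is increasing), so it is stated there with labels exchanged; (D) is on (0,1), since it fails at end points; for α<0 and η_t∈{0,1} the limit value replaces the formula; α* is fixed by convention where the quotient is x/0 or ∞/∞. *)

theory Defs
  imports "HOL-Analysis.Analysis"
begin

text \<open>
  A loss is a function of a label and an estimate; only labels in \<open>{- 1, 1}\<close> and estimates in
  \<open>{0..1}\<close> matter. Values are extended reals, because already the log-loss is infinite at an
  end point of \<open>{0..1}\<close>.
\<close>

type_synonym loss = "int \<Rightarrow> real \<Rightarrow> ereal"

text \<open>On \<^typ>\<open>ereal\<close> we have \<open>0 * \<infinity> = 0\<close>, so an infinite partial loss of weight zero is ignored.\<close>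

definition cond_risk :: "loss \<Rightarrow> real \<Rightarrow> real \<Rightarrow> ereal" where
  "cond_risk l u v = ereal v * l 1 u + ereal (1 - v) * l (- 1) u"

definition tilted_estimate :: "loss \<Rightarrow> real \<Rightarrow> real set" where
  "tilted_estimate l v = {u. is_arg_min (\<lambda>u. cond_risk l u v) (\<lambda>u. u \<in> {0..1}) u}"

definition loss_monotone :: "loss \<Rightarrow> bool" where
  "loss_monotone l \<longleftrightarrow>
     monotone_on {0..1} (\<le>) (\<ge>) (l 1) \<and> monotone_on {0..1} (\<le>) (\<le>) (l (- 1))"

text \<open>
  Differentiability is required in the interior only: at an end point the partial losses may be
  infinite (e.g. \<open>- ln u\<close>) or finite with infinite slope (e.g. \<open>2 * (1 - sqrt u)\<close>).
\<close>

definition loss_differentiable :: "loss \<Rightarrow> bool" where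
  "loss_differentiable l \<longleftrightarrow>
     (\<forall>y\<in>{- 1, 1}. \<forall>u\<in>{0<..<1}.
        \<bar>l y u\<bar> \<noteq> \<infinity> \<and> (\<lambda>w. real_of_ereal (l y w)) differentiable (at u))"

definition loss_symmetric :: "loss \<Rightarrow> bool" where
  "loss_symmetric l \<longleftrightarrow> (\<forall>u\<in>{0..1}. l 1 u = l (- 1) (1 - u))"

text \<open>
  The partial loss of the label 1 for an order \<open>a \<ge> 0\<close>. For \<open>0 < a < 1\<close> the exponent
  \<open>(a - 1) / a\<close> is negative, so that the value at 0 is \<open>\<infinity>\<close>; this case and the one of
  \<open>ln 0\<close> are separated because of \<open>0 powr x = 0\<close> and \<open>ln 0 = 0\<close>.
\<close>

definition alpha_partial :: "ereal \<Rightarrow> real \<Rightarrow> ereal" where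
  "alpha_partial a u =
     (if a = 0 then \<infinity>
      else if a = \<infinity> then ereal (1 - u)
      else if a \<le> 1 \<and> u = 0 then \<infinity>
      else if a = 1 then ereal (- ln u)
      else let r = real_of_ereal a in ereal (r / (r - 1) * (1 - u powr ((r - 1) / r))))"

definition alpha_loss :: "ereal \<Rightarrow> loss" where
  "alpha_loss a y u =
     (if 0 \<le> a then (if y = 1 then alpha_partial a u else alpha_partial a (1 - u))
      else (if y = 1 then alpha_partial (- a) (1 - u) else alpha_partial (- a) u))"

text \<open>
  A negative order exchanges the two partial losses, so \<^const>\<open>loss_monotone\<close> cannot hold for it;
  what is monotone then is the loss with exchanged labels.
\<close>

lemma not_loss_monotone_alpha_loss_neg:
  assumes "a < 0"
  shows "\<not> loss_monotone (alpha_loss a)"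
proof
  assume "loss_monotone (alpha_loss a)"
  hence "alpha_loss a 1 1 \<le> alpha_loss a 1 0"
    by (auto simp: loss_monotone_def monotone_on_def)
  moreover have "alpha_loss a 1 0 = 0"
    using assms by (auto simp: alpha_loss_def alpha_partial_def Let_def)
  moreover have "0 < alpha_loss a 1 1"
    using assms
    by (cases a) (auto simp: alpha_loss_def alpha_partial_def Let_def zero_less_divide_iff
      one_ereal_def field_simps)
  ultimately show False by simp
qed

definition twist :: "(real \<Rightarrow> real) \<Rightarrow> bool" where
  "twist T \<longleftrightarrow> T \<in> {0..1} \<rightarrow> {0..1}"

definition bayes_blunting :: "(real \<Rightarrow> real) \<Rightarrow> bool" where
  "bayes_blunting T \<longleftrightarrow>
     (\<forall>c\<in>{0..1}. (c \<le> T c \<and> T c \<le> 1/2) \<or> (c \<ge> T c \<and> T c \<ge> 1/2))"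

text \<open>The hyperparameter may depend on the clean posterior \<open>c\<close>.\<close>

definition twist_proper :: "('h \<Rightarrow> loss) \<Rightarrow> bool" where
  "twist_proper F \<longleftrightarrow>
     (\<forall>T. twist T \<longrightarrow> (\<forall>c\<in>{0..1}. \<exists>h. c \<in> tilted_estimate (F h) (T c)))"

definition logit :: "real \<Rightarrow> ereal" where
  "logit u = (if u = 0 then -\<infinity> else if u = 1 then \<infinity> else ereal (ln (u / (1 - u))))"

text \<open>
  The order \<open>logit c / logit t\<close>. The remaining cases fix the quotients without a meaning:
  \<open>0 / 0\<close> and \<open>\<infinity> / \<infinity>\<close> are \<open>\<plusminus> 1\<close>, which is the value that \<open>logit c / logit t\<close> has whenever
  \<open>c = t\<close> or \<open>c = 1 - t\<close> and it is defined, and \<open>x / 0\<close> for \<open>x \<noteq> 0\<close> is \<open>\<infinity>\<close>, whatever the sign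
  of \<open>x\<close>, since the denominator has no sign.
\<close>

definition alpha_star :: "real \<Rightarrow> real \<Rightarrow> ereal" where
  "alpha_star c t =
     (if t \<noteq> 1/2 \<and> \<not> (c \<in> {0, 1} \<and> t \<in> {0, 1}) then logit c / logit t
      else if c = t then 1
      else if t = 1/2 then \<infinity>
      else - 1)"

end

theory Submission
  imports Defs
begin

text \<open>
  For a finite order \<open>a > 0\<close> the partial loss of the label 1 is strictly convex with derivative
  \<open>- u powr (- 1 / a)\<close>, so it lies strictly above its tangents. At \<open>w = t powr a / (t powr a + (1 - t) powr a)\<close>
  the tangent slopes of the two weighted partial losses cancel, hence \<open>w\<close> is the only minimizer of
  the conditional risk. Changing the sign of the order replaces \<open>u\<close> by \<open>1 - u\<close> in the
  conditional risk. Since \<open>logit w = a * logit t\<close>, solving for the order gives \<open>logit c / logit t\<close>.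
\<close>

section \<open>Partial losses of positive finite order: derivative and tangents\<close>

text \<open>A real-valued copy to which calculus applies. At \<open>u = 0\<close> with
  \<open>a \<le> 1\<close> it is finite while \<open>alpha_partial\<close> is \<infinity>, so it is
  used for positive arguments only.\<close>

definition alpha_partial_real :: "real \<Rightarrow> real \<Rightarrow> real" where
  "alpha_partial_real a u =
     (if a = 1 then - ln u else a / (a - 1) * (1 - u powr ((a - 1) / a)))"

lemma alpha_partial_eq_real:
  assumes "0 < a" "0 < u"
  shows "alpha_partial (ereal a) u = ereal (alpha_partial_real a u)"
  using assms by (auto simp: alpha_partial_def alpha_partial_real_def Let_def one_ereal_def zero_ereal_def)

lemma alpha_partial_real_has_derivative:
  assumes "0 < a" "0 < u"
  shows "(alpha_partial_real a has_real_derivative - (u powr (- 1 / a))) (at u)"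
proof (cases "a = 1")
  case True
  have "((\<lambda>u. - ln u) has_real_derivative - (u powr (- 1))) (at u)"
    using assms by (auto intro!: derivative_eq_intros simp: powr_minus_divide)
  moreover have "alpha_partial_real a = (\<lambda>u. - ln u)"
    using True by (auto simp: alpha_partial_real_def)
  ultimately show ?thesis using True by simp
next
  case False
  have e: "(a - 1) / a - 1 = - 1 / a" using assms by (simp add: field_simps)
  have "((\<lambda>u. a / (a - 1) * (1 - u powr ((a - 1) / a))) has_real_derivative
      a / (a - 1) * (0 - (a - 1) / a * u powr ((a - 1) / a - 1))) (at u)"
    using \<open>0 < u\<close> by (intro DERIV_cmult DERIV_diff DERIV_const has_real_derivative_powr)
  moreover have "a / (a - 1) * (0 - (a - 1) / a * u powr ((a - 1) / a - 1)) = - (u powr (- 1 / a))"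
    using False assms unfolding e by simp
  moreover have "alpha_partial_real a = (\<lambda>u. a / (a - 1) * (1 - u powr ((a - 1) / a)))"
    using False by (auto simp: alpha_partial_real_def)
  ultimately show ?thesis by simp
qed

text \<open>Strict convexity by the mean value theorem: the derivative
  \<open>- (z powr (- 1 / a))\<close> strictly increases in \<open>z\<close>, so moving away from
  \<open>w\<close> in either direction leaves the tangent upwards.\<close>

lemma alpha_partial_real_above_tangent:
  assumes "0 < a" "0 < w" "0 < u" "u \<noteq> w"
  shows "alpha_partial_real a w - w powr (- 1 / a) * (u - w) < alpha_partial_real a u"
proof (cases "w < u")
  case True
  obtain z where z: "w < z" "z < u"
    "alpha_partial_real a u - alpha_partial_real a w = (u - w) * - (z powr (- 1 / a))"
    using MVT2[OF True, of "alpha_partial_real a" "\<lambda>x. - (x powr (- 1 / a))"]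
      alpha_partial_real_has_derivative[OF \<open>0 < a\<close>] \<open>0 < w\<close> by fastforce
  have "z powr (- 1 / a) < w powr (- 1 / a)"
    using z assms by (intro powr_less_mono2_neg) auto
  with True have "(u - w) * z powr (- 1 / a) < (u - w) * w powr (- 1 / a)" by simp
  with z(3) show ?thesis by (simp add: algebra_simps)
next
  case False
  with assms have less: "u < w" by simp
  obtain z where z: "u < z" "z < w"
    "alpha_partial_real a w - alpha_partial_real a u = (w - u) * - (z powr (- 1 / a))"
    using MVT2[OF less, of "alpha_partial_real a" "\<lambda>x. - (x powr (- 1 / a))"]
      alpha_partial_real_has_derivative[OF \<open>0 < a\<close>] \<open>0 < u\<close> by fastforce
  have "w powr (- 1 / a) < z powr (- 1 / a)"
    using z assms by (intro powr_less_mono2_neg) auto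
  with less have "(w - u) * w powr (- 1 / a) < (w - u) * z powr (- 1 / a)" by simp
  with z(3) show ?thesis by (simp add: algebra_simps)
qed

text \<open>Extends the tangent bound to \<open>u = 0\<close>, where the loss may be infinite or
  have infinite slope.\<close>

lemma alpha_partial_above_tangent:
  assumes "0 < a" "0 < w" "0 \<le> u" "u \<noteq> w"
  shows "ereal (alpha_partial_real a w - w powr (- 1 / a) * (u - w)) < alpha_partial (ereal a) u"
proof (cases "u = 0")
  case False
  with assms alpha_partial_real_above_tangent[of a w u] show ?thesis
    by (simp add: alpha_partial_eq_real)
next
  case True
  show ?thesis
  proof (cases "a \<le> 1")
    case True
    with \<open>u = 0\<close> \<open>0 < a\<close> show ?thesis
      by (simp add: alpha_partial_def one_ereal_def zero_ereal_def)
  next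
    case False
    have "w powr (- 1 / a) * w = w powr (- 1 / a + 1)"
      using \<open>0 < w\<close> by (subst powr_add) simp
    also have "- 1 / a + 1 = (a - 1) / a" using \<open>0 < a\<close> by (simp add: field_simps)
    finally have p: "w powr (- 1 / a) * w = w powr ((a - 1) / a)" .
    \<comment> \<open>With \<open>p = w powr ((a - 1) / a)\<close>, the tangent at \<open>w\<close>
      has the value \<open>a / (a - 1) - p / (a - 1)\<close> at 0, below the loss
      \<open>a / (a - 1)\<close> there.\<close>
    have "1 < a / (a - 1)" using False by (simp add: field_simps)
    then have "1 * w powr ((a - 1) / a) < a / (a - 1) * w powr ((a - 1) / a)"
      using \<open>0 < w\<close> by (intro mult_strict_right_mono) simp_all
    then have "alpha_partial_real a w + w powr (- 1 / a) * w < a / (a - 1)"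
      using False unfolding p by (simp add: alpha_partial_real_def algebra_simps)
    with False \<open>u = 0\<close> show ?thesis
      by (simp add: alpha_partial_def one_ereal_def zero_ereal_def Let_def)
  qed
qed

text \<open>The tangent at \<open>w\<close> has negative slope, so at \<open>u < w\<close> it
  already exceeds the value at \<open>w\<close>, and the loss at \<open>u\<close> exceeds the
  tangent. This covers an infinite value at \<open>u = 0\<close>.\<close>

lemma alpha_partial_strict_antimono:
  assumes "0 < a" "0 \<le> u" "u < w"
  shows "alpha_partial (ereal a) w < alpha_partial (ereal a) u"
proof -
  have "alpha_partial (ereal a) w = ereal (alpha_partial_real a w)"
    using assms by (intro alpha_partial_eq_real) auto
  also have "\<dots> \<le> ereal (alpha_partial_real a w - w powr (- 1 / a) * (u - w))"
    using assms by (auto simp: mult_le_0_iff)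
  also have "\<dots> < alpha_partial (ereal a) u"
    using assms by (intro alpha_partial_above_tangent) auto
  finally show ?thesis .
qed

section \<open>Monotonicity, differentiability and symmetry\<close>

text \<open>Reduces negative orders, including \<open>- \<infinity>\<close>, to positive ones.
  Labels are restricted because \<open>alpha_loss\<close> treats all labels other than 1
  alike.\<close>

lemma alpha_loss_uminus:
  assumes "0 < a" "y \<in> {- 1, 1}"
  shows "alpha_loss (- a) y u = alpha_loss a (- y) u"
proof -
  have "\<not> 0 \<le> - a" using assms(1) by simp
  with assms show ?thesis by (auto simp: alpha_loss_def)
qed

lemma loss_monotone_alpha_loss:
  assumes "0 < a"
  shows "loss_monotone (alpha_loss (ereal a))"
  using assms alpha_partial_strict_antimono[OF assms]
  by (auto simp: loss_monotone_def monotone_on_def alpha_loss_def le_less)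

lemma loss_symmetric_alpha_loss: "loss_symmetric (alpha_loss a)"
  by (simp add: loss_symmetric_def alpha_loss_def)

lemma alpha_partial_differentiable:
  assumes "0 < a" "0 < u"
  shows "(\<lambda>w. real_of_ereal (alpha_partial (ereal a) w)) differentiable (at u)"
proof -
  have "((\<lambda>w. real_of_ereal (alpha_partial (ereal a) w)) has_real_derivative
      - (u powr (- 1 / a))) (at u)"
    \<comment> \<open>The two functions may differ at 0, so the derivative is transferred on the
      open half-line.\<close>
    using alpha_partial_real_has_derivative[OF assms] open_greaterThan[of 0]
  proof (rule has_field_derivative_transform_within_open)
    fix x :: real
    assume "x \<in> {0<..}"
    with \<open>0 < a\<close> show "alpha_partial_real a x = real_of_ereal (alpha_partial (ereal a) x)"
      by (simp add: alpha_partial_eq_real)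
  qed (use assms in simp)
  then show ?thesis by (auto simp: real_differentiable_def)
qed

lemma loss_differentiable_alpha_loss:
  assumes "a \<noteq> 0"
  shows "loss_differentiable (alpha_loss (ereal a))"
proof -
  \<comment> \<open>With \<open>b\<close> the absolute value of the order, both signs involve the
    same two functions, one for each label.\<close>
  have *: "\<bar>alpha_partial (ereal b) u\<bar> \<noteq> \<infinity> \<and>
      (\<lambda>w. real_of_ereal (alpha_partial (ereal b) w)) differentiable (at u) \<and>
      \<bar>alpha_partial (ereal b) (1 - u)\<bar> \<noteq> \<infinity> \<and>
      (\<lambda>w. real_of_ereal (alpha_partial (ereal b) (1 - w))) differentiable (at u)"
    if "0 < b" "0 < u" "u < 1" for b u :: real
  proof -
    have "(\<lambda>w. real_of_ereal (alpha_partial (ereal b) w)) \<circ> (\<lambda>w. 1 - w) differentiable (at u)"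
      using that by (intro differentiable_chain_at alpha_partial_differentiable) auto
    with that show ?thesis
      by (auto simp: alpha_partial_eq_real alpha_partial_differentiable o_def)
  qed
  show ?thesis
  proof (cases "a > 0")
    case True
    with * show ?thesis by (simp add: loss_differentiable_def alpha_loss_def)
  next
    case False
    with assms *[of "- a"] show ?thesis by (simp add: loss_differentiable_def alpha_loss_def)
  qed
qed

section \<open>Minimizers of the conditional risk\<close>

lemma tilted_estimate_eq_singleton:
  assumes "w \<in> {0..1}"
    and "\<And>u. u \<in> {0..1} \<Longrightarrow> u \<noteq> w \<Longrightarrow> cond_risk l w t < cond_risk l u t"
  shows "tilted_estimate l t = {w}"
proof -
  have "\<not> cond_risk l u t < cond_risk l w t" if "u \<in> {0..1}" for u
    using assms(2)[OF that] by (cases "u = w") auto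
  moreover have "u = w" if "u \<in> tilted_estimate l t" for u
    using that assms unfolding tilted_estimate_def is_arg_min_def by blast
  ultimately show ?thesis
    using assms(1) by (auto simp: tilted_estimate_def is_arg_min_def)
qed

lemma tilted_estimate_const:
  assumes "\<And>u. u \<in> {0..1} \<Longrightarrow> cond_risk l u t = r"
  shows "tilted_estimate l t = {0..1}"
  using assms by (auto simp: tilted_estimate_def is_arg_min_def)

text \<open>The reflection of \<open>u\<close> to \<open>1 - u\<close> maps the unit interval onto
  itself and carries one risk to the other, hence minimizers to minimizers.\<close>

lemma tilted_estimate_alpha_loss_uminus:
  assumes "0 < a"
  shows "tilted_estimate (alpha_loss (- a)) t = (\<lambda>u. 1 - u) ` tilted_estimate (alpha_loss a) t"
proof -
  have risk: "cond_risk (alpha_loss (- a)) u t = cond_risk (alpha_loss a) (1 - u) t" for u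
    using assms by (simp add: cond_risk_def alpha_loss_uminus) (simp add: alpha_loss_def)
  have "u \<in> tilted_estimate (alpha_loss (- a)) t \<longleftrightarrow> 1 - u \<in> tilted_estimate (alpha_loss a) t"
    for u
  proof -
    have "(\<exists>v\<in>{0..1}. cond_risk (alpha_loss a) (1 - v) t < r) \<longleftrightarrow>
        (\<exists>v\<in>{0..1}. cond_risk (alpha_loss a) v t < r)" for r
    proof safe
      fix v :: real
      assume "v \<in> {0..1}" "cond_risk (alpha_loss a) v t < r"
      then show "\<exists>v\<in>{0..1}. cond_risk (alpha_loss a) (1 - v) t < r"
        by (intro bexI[of _ "1 - v"]) auto
    qed (auto intro!: bexI)
    then show ?thesis
      by (auto simp: tilted_estimate_def is_arg_min_def risk Bex_def)
  qed
  then show ?thesis by (force simp: image_iff)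
qed

lemma tilted_estimate_alpha_loss_pos:
  assumes "0 < a" "t \<in> {0..1}"
  shows "tilted_estimate (alpha_loss (ereal a)) t = {t powr a / (t powr a + (1 - t) powr a)}"
proof (cases "t \<in> {0, 1}")
  case True
  \<comment> \<open>The term of weight zero vanishes even where its loss is \<infinity>, which
    leaves a single strictly monotone partial loss.\<close>
  have "tilted_estimate (alpha_loss (ereal a)) t = {t}"
    using True assms alpha_partial_strict_antimono[OF \<open>0 < a\<close>]
    by (intro tilted_estimate_eq_singleton)
      (auto simp: cond_risk_def alpha_loss_def zero_ereal_def[symmetric] one_ereal_def[symmetric])
  moreover have "t powr a / (t powr a + (1 - t) powr a) = t" using True by auto
  ultimately show ?thesis by (simp only:)
next
  case False
  with assms have t: "0 < t" "t < 1" by auto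
  define S where "S = t powr a + (1 - t) powr a"
  define w where "w = t powr a / S"
  have S: "0 < S" using t by (simp add: S_def add_pos_pos)
  have "1 - w = (S - t powr a) / S"
    using S by (simp add: w_def diff_divide_distrib)
  then have w1: "1 - w = (1 - t) powr a / S" by (simp add: S_def)
  have w: "0 < w" "0 < 1 - w" unfolding w1 using S t by (simp_all add: w_def)
  \<comment> \<open>First-order condition: the weight \<open>x\<close> cancels against
    \<open>(x powr a) powr (- 1 / a)\<close>, so the result is the same for \<open>x = t\<close> and
    \<open>x = 1 - t\<close>.\<close>
  have slope: "x * (x powr a / S) powr (- 1 / a) = S powr (1 / a)" if "0 < x" for x
  proof -
    have "(x powr a / S) powr (- 1 / a) = (x powr a) powr (- 1 / a) / S powr (- 1 / a)"
      by (rule powr_divide)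
    also have "(x powr a) powr (- 1 / a) = x powr (- 1)"
      using \<open>0 < a\<close> by (simp add: powr_powr)
    also have "\<dots> = 1 / x" using that by (simp add: powr_minus_divide)
    also have "S powr (- 1 / a) = 1 / S powr (1 / a)"
      using powr_minus_divide[of S "1 / a"] by simp
    finally show ?thesis using that by simp
  qed
  have slopes: "t * w powr (- 1 / a) = S powr (1 / a)"
    "(1 - t) * (1 - w) powr (- 1 / a) = S powr (1 / a)"
    using slope[of t] slope[of "1 - t"] t unfolding w1 by (simp_all add: w_def)
  let ?g = "alpha_partial_real a"
  have "cond_risk (alpha_loss (ereal a)) w t < cond_risk (alpha_loss (ereal a)) u t"
    if u: "u \<in> {0..1}" "u \<noteq> w" for u
  proof -
    \<comment> \<open>\<open>p\<close> and \<open>q\<close> are the tangents at \<open>w\<close> and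
      \<open>1 - w\<close>, evaluated at \<open>u\<close> and \<open>1 - u\<close>. By
      \<open>slopes\<close> their weighted sum does not depend on \<open>u\<close> and equals the
      risk at \<open>w\<close>.\<close>
    define p where "p = ?g w - w powr (- 1 / a) * (u - w)"
    define q where "q = ?g (1 - w) - (1 - w) powr (- 1 / a) * (1 - u - (1 - w))"
    have p: "ereal p < alpha_partial (ereal a) u"
      unfolding p_def using u w \<open>0 < a\<close> by (intro alpha_partial_above_tangent) auto
    have q: "ereal q < alpha_partial (ereal a) (1 - u)"
      unfolding q_def using u w \<open>0 < a\<close> by (intro alpha_partial_above_tangent) auto
    have "t * p + (1 - t) * q = t * ?g w + (1 - t) * ?g (1 - w)
        - (t * w powr (- 1 / a)) * (u - w) + ((1 - t) * (1 - w) powr (- 1 / a)) * (u - w)"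
      unfolding p_def q_def by (simp add: algebra_simps)
    then have "t * ?g w + (1 - t) * ?g (1 - w) = t * p + (1 - t) * q"
      unfolding slopes by simp
    moreover have "ereal (t * p + (1 - t) * q) <
        ereal t * alpha_partial (ereal a) u + ereal (1 - t) * alpha_partial (ereal a) (1 - u)"
      \<comment> \<open>Both weights are positive, so strictness survives; the case split admits
        infinite losses at the end points.\<close>
      using p q t
      by (cases "alpha_partial (ereal a) u"; cases "alpha_partial (ereal a) (1 - u)")
        (auto intro!: add_strict_mono)
    ultimately show ?thesis
      using \<open>0 < a\<close> w by (simp add: cond_risk_def alpha_loss_def alpha_partial_eq_real)
  qed
  then have "tilted_estimate (alpha_loss (ereal a)) t = {w}"
    using w by (intro tilted_estimate_eq_singleton) auto
  then show ?thesis by (simp add: w_def S_def)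
qed

lemma tilted_estimate_alpha_loss_neg:
  assumes "a < 0" "t \<in> {0..1}"
  shows "tilted_estimate (alpha_loss (ereal a)) t =
    {1 - t powr (- a) / (t powr (- a) + (1 - t) powr (- a))}"
  using tilted_estimate_alpha_loss_uminus[of "ereal (- a)" t]
    tilted_estimate_alpha_loss_pos[of "- a" t] assms by simp

text \<open>For \<open>a < 0\<close> and interior \<open>t\<close>, inverting the powers turns the
  reflected fraction into the same formula. At an end point \<open>0 powr a = 0\<close> would make
  the formula yield \<open>t\<close>, whereas the minimizer is \<open>1 - t\<close>.\<close>

lemma tilted_estimate_alpha_loss:
  assumes "a \<noteq> 0" "t \<in> {0..1}" "t \<in> {0, 1} \<Longrightarrow> 0 < a"
  shows "tilted_estimate (alpha_loss (ereal a)) t = {t powr a / (t powr a + (1 - t) powr a)}"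
proof (cases "0 < a")
  case True
  with assms show ?thesis by (simp add: tilted_estimate_alpha_loss_pos)
next
  case False
  with assms have a: "a < 0" and t: "0 < t" "t < 1" by (auto simp: less_le)
  have "0 < t powr a" "0 < (1 - t) powr a" using t by auto
  moreover from this have "0 < t powr a + (1 - t) powr a" by (rule add_pos_pos)
  ultimately have "1 - t powr (- a) / (t powr (- a) + (1 - t) powr (- a)) =
      t powr a / (t powr a + (1 - t) powr a)"
    by (simp add: powr_minus field_simps)
  with tilted_estimate_alpha_loss_neg[OF a assms(2)] show ?thesis by simp
qed

lemma tilted_estimate_alpha_loss_zero:
  assumes "t \<in> {0..1}"
  shows "tilted_estimate (alpha_loss 0) t = {0..1}"
proof (rule tilted_estimate_const)
  fix u :: real
  \<comment> \<open>At an end point one term is \<open>0 * \<infinity> = 0\<close>, but the other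
    has weight 1.\<close>
  show "cond_risk (alpha_loss 0) u t = \<infinity>"
    using assms by (cases "t = 0"; cases "t = 1") (auto simp: cond_risk_def alpha_loss_def alpha_partial_def)
qed

text \<open>The risk is affine in \<open>u\<close>, so the sign of \<open>1 - 2 * t\<close> selects
  the minimizing end point.\<close>

lemma cond_risk_alpha_loss_infinity:
  "cond_risk (alpha_loss \<infinity>) u t = ereal (t + (1 - 2 * t) * u)"
  by (simp add: cond_risk_def alpha_loss_def alpha_partial_def algebra_simps)

lemma tilted_estimate_alpha_loss_infinity:
  "tilted_estimate (alpha_loss \<infinity>) t = (if t = 1/2 then {0..1} else if t > 1/2 then {1} else {0})"
proof -
  consider "t = 1/2" | "t > 1/2" | "t < 1/2" by linarith
  then show ?thesis
  proof cases
    case 1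
    then have "tilted_estimate (alpha_loss \<infinity>) t = {0..1}"
      by (intro tilted_estimate_const) (simp only: cond_risk_alpha_loss_infinity, simp)
    with 1 show ?thesis by simp
  next
    case 2
    have "tilted_estimate (alpha_loss \<infinity>) t = {1}"
    proof (rule tilted_estimate_eq_singleton)
      fix u :: real
      assume "u \<in> {0..1}" "u \<noteq> 1"
      \<comment> \<open>This product is the risk at \<open>u\<close> minus the risk at 1.\<close>
      with 2 have "0 < (1 - u) * (2 * t - 1)" by (intro mult_pos_pos) auto
      then show "cond_risk (alpha_loss \<infinity>) 1 t < cond_risk (alpha_loss \<infinity>) u t"
        by (simp add: cond_risk_alpha_loss_infinity algebra_simps)
    qed simp
    with 2 show ?thesis by simp
  next
    case 3
    have "tilted_estimate (alpha_loss \<infinity>) t = {0}"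
      using 3 by (intro tilted_estimate_eq_singleton) (auto simp: cond_risk_alpha_loss_infinity)
    with 3 show ?thesis by simp
  qed
qed

lemma tilted_estimate_alpha_loss_minus_infinity:
  "tilted_estimate (alpha_loss (- \<infinity>)) t =
     (if t = 1/2 then {0..1} else if t > 1/2 then {0} else {1})"
  using tilted_estimate_alpha_loss_uminus[of \<infinity> t]
  by (simp add: tilted_estimate_alpha_loss_infinity)

section \<open>Log-odds and the order \<open>alpha_star\<close>\<close>

text \<open>The odds of the tilted estimate are the odds of \<open>t\<close> to the power
  \<open>a\<close>. By the hypothesis these are the odds of \<open>c\<close>, and odds determine a
  probability.\<close>

lemma powr_ratio_eq_of_logit:
  fixes a c t :: real
  assumes t: "0 < t" "t < 1" and c: "0 < c" "c < 1"
    and "a * ln (t / (1 - t)) = ln (c / (1 - c))"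
  shows "t powr a / (t powr a + (1 - t) powr a) = c"
proof -
  have "t powr a / (1 - t) powr a = (t / (1 - t)) powr a"
    by (rule powr_divide[symmetric])
  also have "\<dots> = exp (ln (c / (1 - c)))"
    using t assms(5) by (simp add: powr_def)
  also have "\<dots> = c / (1 - c)" using c by simp
  finally have "t powr a * (1 - c) = c * (1 - t) powr a"
    using t c by (simp add: field_simps)
  moreover have "0 < t powr a + (1 - t) powr a" using t by (simp add: add_pos_pos)
  ultimately show ?thesis by (simp add: field_simps)
qed

lemma ln_odds_sgn:
  assumes "0 < u" "u < (1::real)"
  shows "0 < ln (u / (1 - u)) \<longleftrightarrow> 1/2 < u" "ln (u / (1 - u)) < 0 \<longleftrightarrow> u < 1/2"
    "ln (u / (1 - u)) = 0 \<longleftrightarrow> u = 1/2"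
  using assms by (simp_all add: field_simps)

lemma alpha_star_interior:
  assumes "0 < t" "t < 1" "t \<noteq> 1/2" "0 < c" "c < 1"
  shows "alpha_star c t = ereal (ln (c / (1 - c)) / ln (t / (1 - t)))"
  using assms ln_odds_sgn(3)[of t] by (simp add: alpha_star_def logit_def)

lemma alpha_star_zero_one:
  assumes "0 < t" "t < 1" "t \<noteq> 1/2"
  shows "alpha_star 1 t = (if 1/2 < t then \<infinity> else - \<infinity>)"
    "alpha_star 0 t = (if 1/2 < t then - \<infinity> else \<infinity>)"
  using assms ln_odds_sgn[of t] by (auto simp: alpha_star_def logit_def divide_ereal_def)

lemma alpha_star_mem_tilted_estimate:
  assumes c: "c \<in> {0..1}" and t: "t \<in> {0..1}"
  shows "c \<in> tilted_estimate (alpha_loss (alpha_star c t)) t"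
proof (cases "t = 1/2")
  case True
  show ?thesis
  proof (cases "c = t")
    case True
    have "alpha_star c t = ereal 1"
      using True \<open>t = 1/2\<close> by (simp add: alpha_star_def)
    moreover have "tilted_estimate (alpha_loss (ereal 1)) t = {t}"
      using t by (subst tilted_estimate_alpha_loss_pos) auto
    ultimately show ?thesis using True by simp
  next
    case False
    \<comment> \<open>At \<open>t = 1/2\<close> the risk of infinite order is constant, so every
      \<open>c\<close> is a minimizer.\<close>
    then have "alpha_star c t = \<infinity>" using \<open>t = 1/2\<close> by (simp add: alpha_star_def)
    moreover have "tilted_estimate (alpha_loss \<infinity>) t = {0..1}"
      unfolding tilted_estimate_alpha_loss_infinity using True by (rule if_P)
    ultimately show ?thesis using c by simp
  qed
next
  case t_half: False
  consider (both) "c \<in> {0, 1}" "t \<in> {0, 1}" | (t_end) "0 < c" "c < 1" "t \<in> {0, 1}"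
    | (c_end) "c \<in> {0, 1}" "0 < t" "t < 1" | (inner) "0 < c" "c < 1" "0 < t" "t < 1"
    using c t by fastforce
  then show ?thesis
  proof cases
    case both
    show ?thesis
    proof (cases "c = t")
      case True
      have "alpha_star c t = ereal 1"
        using True both by (auto simp: alpha_star_def)
      moreover have "tilted_estimate (alpha_loss (ereal 1)) t = {t}"
        using t by (subst tilted_estimate_alpha_loss_pos) auto
      ultimately show ?thesis using True by simp
    next
      case False
      \<comment> \<open>Here \<open>c = 1 - t\<close>, and order \<open>- 1\<close> reflects the
        estimate \<open>t\<close> of the log-loss.\<close>
      have "alpha_star c t = ereal (- 1)"
        using False both t_half by (auto simp: alpha_star_def one_ereal_def)
      with False both show ?thesis
        by (auto simp: tilted_estimate_alpha_loss_neg simp del: uminus_ereal.simps)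
    qed
  next
    case t_end
    \<comment> \<open>A finite log-odds divided by an infinite one is 0, and at order 0 every
      estimate is optimal.\<close>
    then have "alpha_star c t = 0"
      by (auto simp: alpha_star_def logit_def)
    then show ?thesis using c t by (simp add: tilted_estimate_alpha_loss_zero)
  next
    case c_end
    with t_half show ?thesis
      by (auto simp: alpha_star_zero_one tilted_estimate_alpha_loss_infinity
          tilted_estimate_alpha_loss_minus_infinity)
  next
    case inner
    let ?a = "ln (c / (1 - c)) / ln (t / (1 - t))"
    have star: "alpha_star c t = ereal ?a"
      using inner t_half by (intro alpha_star_interior)
    have nz: "ln (t / (1 - t)) \<noteq> 0" using inner t_half ln_odds_sgn(3) by blast
    \<comment> \<open>The order vanishes exactly for \<open>c = 1/2\<close>; the power formula is
      available for nonzero orders only.\<close>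
    show ?thesis
    proof (cases "?a = 0")
      case True
      with star have "alpha_star c t = 0" by simp
      then show ?thesis using c t by (simp add: tilted_estimate_alpha_loss_zero)
    next
      case False
      have "tilted_estimate (alpha_loss (ereal ?a)) t
          = {t powr ?a / (t powr ?a + (1 - t) powr ?a)}"
        using False inner by (intro tilted_estimate_alpha_loss) auto
      also have "\<dots> = {c}"
        using inner nz by (subst powr_ratio_eq_of_logit[of t c]) auto
      finally show ?thesis unfolding star by simp
    qed
  qed
qed

lemma twist_proper_alpha_loss: "twist_proper alpha_loss"
  unfolding twist_proper_def twist_def
  by (meson Pi_mem alpha_star_mem_tilted_estimate)

section \<open>Bayes blunting twists\<close>

lemma ln_odds_mono:
  assumes "0 < u" "u \<le> v" "v < (1::real)"
  shows "ln (u / (1 - u)) \<le> ln (v / (1 - v))"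
  using assms by (intro ln_mono frac_le) auto

text \<open>Blunting keeps \<open>c\<close> on the side of 1/2 where \<open>t\<close> lies, or at
  \<open>t\<close>, and no closer to 1/2. For interior values other than \<open>t = 1/2\<close> the
  log-odds thus have the same sign, that of \<open>c\<close> being at least as large in absolute
  value.\<close>

lemma one_le_alpha_star:
  assumes c: "c \<in> {0..1}" and t: "t \<in> {0..1}"
    and blunt: "(c \<le> t \<and> t \<le> 1/2) \<or> (c \<ge> t \<and> t \<ge> 1/2)"
  shows "1 \<le> alpha_star c t"
proof (cases "t = 1/2 \<or> t \<in> {0, 1}")
  case True
  \<comment> \<open>At an end point \<open>t\<close>, blunting forces \<open>c = t\<close> and the
    order is 1; at \<open>t = 1/2\<close> it is 1 or \<infinity>.\<close>
  with assms show ?thesis by (auto simp: alpha_star_def)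
next
  case False
  with t have t': "0 < t" "t < 1" "t \<noteq> 1/2" by auto
  show ?thesis
  proof (cases "c \<in> {0, 1}")
    case True
    with blunt t' show ?thesis by (auto simp: alpha_star_zero_one)
  next
    case False
    with c have c': "0 < c" "c < 1" by auto
    have "1 \<le> ln (c / (1 - c)) / ln (t / (1 - t))"
    proof (cases "t < 1/2")
      case True
      with blunt have "c \<le> t" by auto
      then show ?thesis
        \<comment> \<open>The log-odds of \<open>t\<close> are negative, so dividing by them
          reverses the inequality.\<close>
        using ln_odds_mono[of c t] ln_odds_sgn(2)[of t] t' c' True
        by (simp add: le_divide_eq)
    next
      case False
      with blunt t' have "t \<le> c" "1/2 < t" by auto
      then show ?thesis
        using ln_odds_mono[of t c] ln_odds_sgn(1)[of t] t' c'
        by (simp add: le_divide_eq)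
    qed
    then show ?thesis using t' c' by (simp add: alpha_star_interior)
  qed
qed

theorem lemma8:
  shows
   "((\<forall>a::real. a \<noteq> 0 \<longrightarrow>
        (if a > 0 then loss_monotone (alpha_loss (ereal a))
         else loss_monotone (\<lambda>y. alpha_loss (ereal a) (- y))) \<and>
        loss_differentiable (alpha_loss (ereal a)) \<and>
        loss_symmetric (alpha_loss (ereal a)))) \<and>
    ((\<forall>t\<in>{0..1}. tilted_estimate (alpha_loss 0) t = {0..1}) \<and>
     tilted_estimate (alpha_loss \<infinity>) (1/2) = {0..1} \<and>
     tilted_estimate (alpha_loss (-\<infinity>)) (1/2) = {0..1} \<and>
     (\<forall>(a::real) t. a \<noteq> 0 \<and> t \<in> {0..1} \<and> (t \<in> {0, 1} \<longrightarrow> a > 0) \<longrightarrow>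
        tilted_estimate (alpha_loss (ereal a)) t = {t powr a / (t powr a + (1 - t) powr a)}) \<and>
     (\<forall>a::real. a < 0 \<longrightarrow>
        tilted_estimate (alpha_loss (ereal a)) 0 = {1} \<and>
        tilted_estimate (alpha_loss (ereal a)) 1 = {0}) \<and>
     (\<forall>t\<in>{1/2<..1}. tilted_estimate (alpha_loss \<infinity>) t = {1} \<and>
        tilted_estimate (alpha_loss (-\<infinity>)) t = {0}) \<and>
     (\<forall>t\<in>{0..<1/2}. tilted_estimate (alpha_loss \<infinity>) t = {0} \<and>
        tilted_estimate (alpha_loss (-\<infinity>)) t = {1})) \<and>
    (twist_proper alpha_loss \<and>
     (\<forall>T. twist T \<longrightarrow>
        (\<forall>c\<in>{0..1}. c \<in> tilted_estimate (alpha_loss (alpha_star c (T c))) (T c)))) \<and>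
    (\<forall>T. twist T \<and> bayes_blunting T \<longrightarrow> (\<forall>c\<in>{0..1}. 1 \<le> alpha_star c (T c)))"
proof (intro conjI allI ballI impI)
  fix a :: real
  assume "a \<noteq> 0"
  show "if a > 0 then loss_monotone (alpha_loss (ereal a))
      else loss_monotone (\<lambda>y. alpha_loss (ereal a) (- y))"
  proof (cases "a > 0")
    case True
    then show ?thesis by (simp add: loss_monotone_alpha_loss)
  next
    case False
    with \<open>a \<noteq> 0\<close> have "loss_monotone (alpha_loss (ereal (- a)))"
      by (intro loss_monotone_alpha_loss) simp
    moreover have "alpha_loss (ereal a) (- y) = alpha_loss (ereal (- a)) y" if "y \<in> {- 1, 1}" for y
      using alpha_loss_uminus[of "ereal (- a)" "- y"] that False \<open>a \<noteq> 0\<close> by auto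
    \<comment> \<open>The relabelled loss and the loss of order \<open>- a\<close> agree on the
      labels 1 and -1 only, which are all that \<open>loss_monotone\<close> inspects.\<close>
    from this[of 1] this[of "- 1"]
    have "alpha_loss (ereal a) (- 1) = alpha_loss (ereal (- a)) 1"
      "alpha_loss (ereal a) (- (- 1)) = alpha_loss (ereal (- a)) (- 1)" by simp_all
    ultimately show ?thesis using False by (simp only: loss_monotone_def if_False)
  qed
  show "loss_differentiable (alpha_loss (ereal a))"
    using \<open>a \<noteq> 0\<close> by (rule loss_differentiable_alpha_loss)
  show "loss_symmetric (alpha_loss (ereal a))"
    by (rule loss_symmetric_alpha_loss)
next
  fix T c
  assume "twist T" "c \<in> {0..1::real}"
  then show "c \<in> tilted_estimate (alpha_loss (alpha_star c (T c))) (T c)"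
    by (intro alpha_star_mem_tilted_estimate) (auto simp: twist_def)
next
  fix T c
  assume "twist T \<and> bayes_blunting T" "c \<in> {0..1::real}"
  then show "1 \<le> alpha_star c (T c)"
    by (intro one_le_alpha_star) (auto simp: twist_def bayes_blunting_def)
next
  fix a t :: real
  assume "a \<noteq> 0 \<and> t \<in> {0..1} \<and> (t \<in> {0, 1} \<longrightarrow> a > 0)"
  then show "tilted_estimate (alpha_loss (ereal a)) t = {t powr a / (t powr a + (1 - t) powr a)}"
    by (intro tilted_estimate_alpha_loss) auto
qed (simp_all add: tilted_estimate_alpha_loss_zero
    tilted_estimate_alpha_loss_neg tilted_estimate_alpha_loss_infinity
    tilted_estimate_alpha_loss_minus_infinity twist_proper_alpha_loss)

end
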